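(* Let $J=([n],\mathcal{B})$ be an integral polymatroid and let $G_J$ be its basis graph. Then any two walks in $G_J$ with the same end-points (the same first vertex and the same last vertex) are combinatorially homotopic.
   Context: Let $[n]=\{1,\dots,n\}$, let $\mathbf{e}_1,\dots,\mathbf{e}_n$ be the standard basis of $\mathbb{R}^n$, and let $\Delta_n^r=\{\alpha\in\mathbb{Z}_{\ge 0}^n:\sum_{i=1}^n\alpha_i=r\}$. An integral polymatroid on $[n]$ is a pair $([n],\mathcal{B})$ where $\mathcal{B}$ is a non-empty subset of some $\Delta_n^r$ such that for all $\alpha,\alpha'\in\mathcal{B}$ and $i\in[n]$ with $\alpha_i>\alpha'_i$, there is $j\in[n]$ with $\alpha_j<\alpha'_j$ and $\alpha-\mathbf{e}_i+\mathbf{e}_j\in\mathcal{B}$. The basis graph $G_J$ of an integral polymatroid $J=([n],\mathcal{B})$ is the graph with vertex set $\mathcal{B}$ in which $\alpha$ and $\alpha'$ are adjacent if and only if $|\alpha-\alpha'|=2$, where $|\gamma|:=|\gamma_1|+\cdots+|\gamma_n|$ for $\gamma\in\mathbb{Z}^n$. Graphs are undirected and simple. A walk in a graph is a sequence of vertices $v_0v_1\cdots v_l$ in which consecutive vertices are adjacent. The elementary transformations relating two walks $W_1,W_2$ are: (i) deletion: $W_1=v_0\cdots v_{k-1}v_kv_{k+1}\cdots v_l$ and $W_2=v_0\cdots v_{k-1}v_{k+2}\cdots v_l$ for some $k$ with $v_{k-1}=v_{k+1}$; (ii) shortcut: $W_1=v_0\cdots v_{k-1}v_kv_{k+1}\cdots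 v_l$ and $W_2=v_0\cdots v_{k-1}v_{k+1}\cdots v_l$ for some $k$ with $v_{k-1}\neq v_{k+1}$ (both are walks, so $v_{k-1}$ and $v_{k+1}$ are adjacent); (iii) 2-switch: $W_1=v_0\cdots v_{k-1}v_kv_{k+1}\cdots v_l$ and $W_2=v_0\cdots v_{k-1}v_k'v_{k+1}\cdots v_l$ for some $k$, where $v_{k-1}$ and $v_{k+1}$ are at distance exactly $2$ in the graph. Two walks are combinatorially homotopic if one can be obtained from the other by a finite sequence of elementary transformations, each used in either direction. *)

theory Defs
  imports Main "HOL-Library.Extended_Nat"
begin

text \<open>Vectors in \<open>\<int>\<^sup>n\<close> are functions \<open>nat \<Rightarrow> int\<close> that vanish outside \<open>{1..n}\<close>, so
  that equality of vectors is equality of functions.\<close>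

definition std_basis :: "nat \<Rightarrow> nat \<Rightarrow> int" where
  "std_basis i = (\<lambda>k. if k = i then 1 else 0)"

definition simplex_points :: "nat \<Rightarrow> nat \<Rightarrow> (nat \<Rightarrow> int) set" where
  "simplex_points n r =
     {\<alpha>. (\<forall>i\<in>{1..n}. 0 \<le> \<alpha> i) \<and> (\<forall>i. i \<notin> {1..n} \<longrightarrow> \<alpha> i = 0) \<and> (\<Sum>i=1..n. \<alpha> i) = int r}"

definition integral_polymatroid :: "nat \<Rightarrow> (nat \<Rightarrow> int) set \<Rightarrow> bool" where
  "integral_polymatroid n B \<longleftrightarrow>
     B \<noteq> {} \<and> (\<exists>r. B \<subseteq> simplex_points n r) \<and>
     (\<forall>\<alpha>\<in>B. \<forall>\<alpha>'\<in>B. \<forall>i\<in>{1..n}. \<alpha> i > \<alpha>' i \<longrightarrow>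
        (\<exists>j\<in>{1..n}. \<alpha> j < \<alpha>' j \<and> (\<lambda>k. \<alpha> k - std_basis i k + std_basis j k) \<in> B))"

definition l1_norm :: "nat \<Rightarrow> (nat \<Rightarrow> int) \<Rightarrow> int" where
  "l1_norm n \<gamma> = (\<Sum>i=1..n. \<bar>\<gamma> i\<bar>)"

text \<open>A graph consists of a vertex set and a set of edges, an edge being the set of its two
  end-points.\<close>

type_synonym 'a graph = "'a set \<times> 'a set set"

definition basis_graph :: "nat \<Rightarrow> (nat \<Rightarrow> int) set \<Rightarrow> (nat \<Rightarrow> int) graph" where
  "basis_graph n B =
     (B, {{\<alpha>, \<alpha>'} | \<alpha> \<alpha>'. \<alpha> \<in> B \<and> \<alpha>' \<in> B \<and> l1_norm n (\<lambda>k. \<alpha> k - \<alpha>' k) = 2})"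

definition adjacent :: "'a graph \<Rightarrow> 'a \<Rightarrow> 'a \<Rightarrow> bool" where
  "adjacent G u v \<longleftrightarrow> {u, v} \<in> snd G"

definition walk :: "'a graph \<Rightarrow> 'a list \<Rightarrow> bool" where
  "walk G W \<longleftrightarrow> W \<noteq> [] \<and> set W \<subseteq> fst G \<and> successively (adjacent G) W"

text \<open>The distance is \<open>\<infinity>\<close> if there is no walk from \<open>u\<close> to \<open>v\<close>.\<close>

definition graph_dist :: "'a graph \<Rightarrow> 'a \<Rightarrow> 'a \<Rightarrow> enat" where
  "graph_dist G u v =
     (INF W \<in> {W. walk G W \<and> hd W = u \<and> last W = v}. enat (length W - 1))"

text \<open>In the following rules \<open>u\<close>, \<open>v\<close>, \<open>w\<close> are the vertices with indices \<open>k - 1\<close>, \<open>k\<close>, \<open>k + 1\<close>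
  of the first walk.\<close>

inductive elementary :: "'a graph \<Rightarrow> 'a list \<Rightarrow> 'a list \<Rightarrow> bool" for G where
  deletion:
    "walk G (p @ [u, v, u] @ s) \<Longrightarrow> walk G (p @ [u] @ s) \<Longrightarrow>
     elementary G (p @ [u, v, u] @ s) (p @ [u] @ s)"
| shortcut:
    "walk G (p @ [u, v, w] @ s) \<Longrightarrow> walk G (p @ [u, w] @ s) \<Longrightarrow> u \<noteq> w \<Longrightarrow>
     elementary G (p @ [u, v, w] @ s) (p @ [u, w] @ s)"
| two_switch:
    "walk G (p @ [u, v, w] @ s) \<Longrightarrow> walk G (p @ [u, v', w] @ s) \<Longrightarrow> graph_dist G u w = 2 \<Longrightarrow>
     elementary G (p @ [u, v, w] @ s) (p @ [u, v', w] @ s)"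

definition comb_homotopic :: "'a graph \<Rightarrow> 'a list \<Rightarrow> 'a list \<Rightarrow> bool" where
  "comb_homotopic G = (\<lambda>W W'. elementary G W W' \<or> elementary G W' W)\<^sup>*\<^sup>*"

end

theory Submission
  imports Defs
begin

text \<open>
  Fix the common first vertex \<open>r\<close> of the walks and measure the level of a basis by its distance
  from \<open>r\<close>. The exchange axiom shows that adjacent bases of equal level have a common neighbour
  one level below, and that two lower neighbours of a basis are joined, through triangles and a
  single square, by a path that avoids the basis. By induction on the level, any two level-increasing
  walks from \<open>r\<close> to the same basis are homotopic; appending one edge at a time, every walk from \<open>r\<close>
  is then homotopic to a level-increasing one.
\<close>

section \<open>Homotopy of walks\<close>

lemma adjacent_commute: "adjacent G u v \<longleftrightarrow> adjacent G v u"
  by (simp add: adjacent_def insert_commute)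

lemma walk_snoc:
  "W \<noteq> [] \<Longrightarrow> walk G (W @ [v]) \<longleftrightarrow> walk G W \<and> v \<in> fst G \<and> adjacent G (last W) v"
  by (auto simp: walk_def successively_append_iff)

lemma comb_homotopic_refl [simp]: "comb_homotopic G W W"
  by (simp add: comb_homotopic_def)

lemma comb_homotopic_trans [trans]:
  "comb_homotopic G W W' \<Longrightarrow> comb_homotopic G W' W'' \<Longrightarrow> comb_homotopic G W W''"
  unfolding comb_homotopic_def by (rule rtranclp_trans)

lemma comb_homotopic_sym: "comb_homotopic G W W' \<Longrightarrow> comb_homotopic G W' W"
  unfolding comb_homotopic_def
  by (rule sympD[OF symp_rtranclp]) (auto intro: sympI)

lemma elementary_comb_homotopic: "elementary G W W' \<Longrightarrow> comb_homotopic G W W'"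
  unfolding comb_homotopic_def by blast

lemma elementary_walk:
  "elementary G W W' \<Longrightarrow> walk G W \<and> walk G W' \<and> last W = last W'"
  by (induction rule: elementary.induct) (auto simp: last_append)

lemma walk_nonempty: "walk G W \<Longrightarrow> W \<noteq> []"
  by (simp add: walk_def)

section \<open>Compatibility of homotopy with appending an edge\<close>

lemma elementary_snoc:
  assumes "elementary G W W'" "v \<in> fst G" "adjacent G (last W) v"
  shows "elementary G (W @ [v]) (W' @ [v])"
proof -
  have ww: "walk G (W @ [v])" "walk G (W' @ [v])"
    using assms elementary_walk[OF assms(1)] walk_snoc walk_nonempty by metis+
  from assms(1) show ?thesis
  proof cases
    case (deletion p u x s)
    then show ?thesis using elementary.deletion[of G p u x "s @ [v]"] ww by simp
  next
    case (shortcut p u x w s)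
    then show ?thesis using elementary.shortcut[of G p u x w "s @ [v]"] ww by simp
  next
    case (two_switch p u x w s x')
    then show ?thesis using elementary.two_switch[of G p u x w "s @ [v]" x'] ww by simp
  qed
qed

lemma comb_homotopic_snoc:
  assumes "comb_homotopic G W W'" "v \<in> fst G" "adjacent G (last W) v"
  shows "comb_homotopic G (W @ [v]) (W' @ [v])"
proof -
  \<comment> \<open>The equality of last vertices is carried through the induction so that the edge
    to \<open>v\<close> can be appended to every intermediate walk.\<close>
  have "comb_homotopic G (W @ [v]) (W' @ [v]) \<and> last W' = last W"
    using assms(1)[unfolded comb_homotopic_def]
  proof (induction rule: rtranclp_induct)
    case (step Y Z)
    then have "last Z = last Y" using elementary_walk by metis
    moreover have "comb_homotopic G (Y @ [v]) (Z @ [v])"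
      using step assms(2,3) elementary_snoc[of G Y Z v] elementary_snoc[of G Z Y v] \<open>last Z = last Y\<close>
        elementary_comb_homotopic comb_homotopic_sym by metis
    ultimately show ?case using step.IH comb_homotopic_trans by metis
  qed simp
  then show ?thesis ..
qed

text \<open>The given walk bounds the infimum from above; a walk with at most two vertices would
  make \<open>u\<close> and \<open>w\<close> equal or adjacent.\<close>

lemma graph_dist_eq_2:
  assumes "walk G [u, v, w]" "u \<noteq> w" "\<not> adjacent G u w"
  shows "graph_dist G u w = 2"
proof (rule antisym)
  have "graph_dist G u w \<le> enat (length [u, v, w] - 1)"
    unfolding graph_dist_def by (rule INF_lower) (use assms in auto)
  then show "graph_dist G u w \<le> 2" by (simp add: numeral_eq_enat numeral_2_eq_2)
next
  show "2 \<le> graph_dist G u w"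
    unfolding graph_dist_def
  proof (rule INF_greatest)
    fix W assume "W \<in> {W. walk G W \<and> hd W = u \<and> last W = w}"
    then have W: "walk G W" "hd W = u" "last W = w" by auto
    have "length W \<ge> 3"
    proof (rule ccontr)
      assume "\<not> length W \<ge> 3"
      then have "length W = 0 \<or> length W = 1 \<or> length W = 2" by linarith
      then consider "W = []" | x where "W = [x]" | x y where "W = [x, y]"
        by (auto simp: length_Suc_conv numeral_2_eq_2)
      then show False using W assms(2,3) by cases (auto simp: walk_def)
    qed
    then show "2 \<le> enat (length W - 1)" by (simp add: numeral_eq_enat)
  qed
qed

text \<open>The three elementary transformations cover the three possible relations of
  \<open>u\<close> and \<open>w\<close>. If these are equal or adjacent, both walks reduce to the
  same shorter walk; otherwise one 2-switch suffices.\<close>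

lemma comb_homotopic_replace_middle:
  assumes "walk G (p @ [u, v, w])" "walk G (p @ [u, v', w])"
  shows "comb_homotopic G (p @ [u, v, w]) (p @ [u, v', w])"
proof -
  have uvw: "walk G [u, v, w]" and pu: "walk G (p @ [u])"
    using assms(1) by (auto simp: walk_def successively_append_iff)
  consider "u = w" | "u \<noteq> w" "adjacent G u w" | "u \<noteq> w" "\<not> adjacent G u w" by blast
  then show ?thesis
  proof cases
    case 1
    then have "elementary G (p @ [u, v, w]) (p @ [u])" "elementary G (p @ [u, v', w]) (p @ [u])"
      using assms pu elementary.deletion[of G p u v "[]"] elementary.deletion[of G p u v' "[]"]
      by auto
    then show ?thesis
      using comb_homotopic_trans comb_homotopic_sym elementary_comb_homotopic by metis
  next
    case 2
    then have "walk G (p @ [u, w])"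
      using pu uvw walk_snoc[of "p @ [u]" G w] by (auto simp: walk_def)
    then have "elementary G (p @ [u, v, w]) (p @ [u, w])" "elementary G (p @ [u, v', w]) (p @ [u, w])"
      using 2 assms elementary.shortcut[of G p u v w "[]"] elementary.shortcut[of G p u v' w "[]"]
      by auto
    then show ?thesis
      using comb_homotopic_trans comb_homotopic_sym elementary_comb_homotopic by metis
  next
    case 3
    then show ?thesis
      using assms graph_dist_eq_2[OF uvw] elementary.two_switch[of G p u v w "[]" v']
      by (auto intro: elementary_comb_homotopic)
  qed
qed

section \<open>Levelled graphs\<close>

text \<open>The interface between the homotopy argument and polymatroids. The axioms force
  \<open>d\<close> to be the distance from \<open>r\<close>. In the last alternative of
  \<open>diamond\<close>, \<open>x\<close> lies on the level of \<open>u\<close> and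
  \<open>w\<close>, so the triangles \<open>u x v\<close> and \<open>x w v\<close> share the edge
  \<open>x v\<close>.\<close>

locale levelled_graph =
  fixes G :: "'a graph" and d :: "'a \<Rightarrow> nat" and r :: 'a
  assumes adjacent_irrefl: "\<not> adjacent G u u"
    and adjacent_in: "adjacent G u v \<Longrightarrow> u \<in> fst G"
    and root_in: "r \<in> fst G"
    and level_root: "d r = 0"
    and level_0: "v \<in> fst G \<Longrightarrow> d v = 0 \<Longrightarrow> v = r"
    and level_step: "adjacent G u v \<Longrightarrow> d v \<le> Suc (d u)"
    and parent: "v \<in> fst G \<Longrightarrow> d v > 0 \<Longrightarrow> \<exists>u. adjacent G u v \<and> d v = Suc (d u)"
    and common_parent: "adjacent G u v \<Longrightarrow> d u = d v \<Longrightarrow>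
      \<exists>x. adjacent G x u \<and> adjacent G x v \<and> d u = Suc (d x)"
    and diamond: "adjacent G u v \<Longrightarrow> adjacent G w v \<Longrightarrow> d v = Suc (d u) \<Longrightarrow> d v = Suc (d w) \<Longrightarrow>
      u = w \<or> adjacent G u w \<or> (\<exists>x. adjacent G x u \<and> adjacent G x w \<and> d u = Suc (d x)) \<or>
      (\<exists>x. adjacent G u x \<and> adjacent G x w \<and> adjacent G x v \<and> d x = d u)"
begin

section \<open>Level-increasing walks from the root\<close>

lemma adjacent_in': "adjacent G u v \<Longrightarrow> v \<in> fst G"
  using adjacent_in adjacent_commute by metis

text \<open>These are the geodesics starting at \<open>r\<close>; generating them at the right end
  matches the induction on the level of the last vertex.\<close>

inductive ascending :: "'a list \<Rightarrow> bool" where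
  root: "ascending [r]"
| snoc: "ascending W \<Longrightarrow> adjacent G (last W) v \<Longrightarrow> d v = Suc (d (last W)) \<Longrightarrow> ascending (W @ [v])"

lemma ascending_walk: "ascending W \<Longrightarrow> walk G W"
proof (induction rule: ascending.induct)
  case root
  then show ?case using root_in by (simp add: walk_def)
next
  case (snoc W v)
  then show ?case using adjacent_in' walk_snoc walk_nonempty by metis
qed

lemma ascending_exists: "v \<in> fst G \<Longrightarrow> \<exists>W. ascending W \<and> last W = v"
proof (induction "d v" arbitrary: v)
  case 0
  then show ?case using level_0 ascending.root by (metis last.simps)
next
  case (Suc m)
  then obtain u where u: "adjacent G u v" "d v = Suc (d u)" using parent by (metis zero_less_Suc)
  then obtain W where "ascending W" "last W = u" using Suc adjacent_in by (metis nat.inject)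
  then have "ascending (W @ [v])" using u by (intro ascending.snoc) auto
  then show ?case by (metis last_snoc)
qed

lemma ascending_snocD:
  assumes "ascending W" "d (last W) = Suc m"
  obtains P where "W = P @ [last W]" "ascending P" "adjacent G (last P) (last W)" "d (last P) = m"
  using assms(1)
proof cases
  case root
  then show ?thesis using assms level_root by simp
next
  case (snoc P v)
  then show ?thesis using that assms by simp
qed

text \<open>Induction on the level of the common end \<open>v\<close>: the vertices before
  \<open>v\<close> on the two walks are lower neighbours of \<open>v\<close>, and
  \<open>diamond\<close> says how they are connected.\<close>

lemma ascending_unique:
  assumes "ascending W" "ascending W'" "last W = last W'"
  shows "comb_homotopic G W W'"
  using assms
proof (induction "d (last W)" arbitrary: W W')
  case 0
  from 0(2) have "W = [r]" using 0(1) by cases auto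
  moreover from 0(3) have "W' = [r]" using 0(1,4) by cases auto
  ultimately show ?case by simp
next
  case (Suc m)
  define v where "v = last W"
  have v: "d v = Suc m" "v \<in> fst G"
    using Suc(2) ascending_walk[OF Suc(3)] by (auto simp: v_def walk_def)
  obtain P where P: "W = P @ [v]" "ascending P" "adjacent G (last P) v" "d (last P) = m"
    using ascending_snocD[OF Suc(3)] Suc(2) v_def by metis
  obtain Q where Q: "W' = Q @ [v]" "ascending Q" "adjacent G (last Q) v" "d (last Q) = m"
    using ascending_snocD[OF Suc(4)] Suc(2,5) v_def by metis
  have same: "comb_homotopic G (X @ [v]) (Y @ [v])"
    if "ascending X" "ascending Y" "last X = last Y" "d (last X) = m" "adjacent G (last X) v" for X Y
    using comb_homotopic_snoc Suc(1) that v(2) by metis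
  \<comment> \<open>A walk reaching \<open>v\<close> by way of \<open>last X\<close> can be rerouted
    through any lower neighbour of \<open>last X\<close>, since the induction hypothesis applies at
    level \<open>m\<close>.\<close>
  have through: "comb_homotopic G (X @ [v]) (Z @ [last X, v])" "walk G (Z @ [last X, v])"
    if "ascending X" "adjacent G (last X) v" "d (last X) = m"
      "ascending Z" "adjacent G (last Z) (last X)" "m = Suc (d (last Z))" for X Z
  proof -
    have a: "ascending (Z @ [last X])" using that by (intro ascending.snoc) auto
    then show "comb_homotopic G (X @ [v]) (Z @ [last X, v])"
      using same[of X "Z @ [last X]"] that by simp
    have "ascending ((Z @ [last X]) @ [v])" using a that v by (intro ascending.snoc) auto
    then show "walk G (Z @ [last X, v])" using ascending_walk by fastforce
  qed
  \<comment> \<open>After rerouting both walks through the common lower neighbour \<open>x\<close>,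
    they differ only in the vertex between \<open>x\<close> and \<open>v\<close>.\<close>
  have square: "comb_homotopic G (X @ [v]) (Y @ [v])"
    if XY: "ascending X" "ascending Y" "adjacent G (last X) v" "adjacent G (last Y) v"
      "d (last X) = m" "d (last Y) = m"
      and x: "adjacent G x (last X)" "adjacent G x (last Y)" "m = Suc (d x)" for X Y x
  proof -
    obtain Z where Z: "ascending Z" "last Z = x" using ascending_exists x adjacent_in by metis
    then obtain p where p: "Z = p @ [x]" by (metis append_butlast_last_id ascending_walk walk_nonempty)
    have "comb_homotopic G (Z @ [last X, v]) (Z @ [last Y, v])"
      using comb_homotopic_replace_middle[of G p x "last X" v "last Y"]
        through(2)[of X Z] through(2)[of Y Z] XY x Z p by simp
    then show ?thesis
      using through(1)[of X Z] through(1)[of Y Z] XY x Z comb_homotopic_trans comb_homotopic_sym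
      by metis
  qed
  \<comment> \<open>The edge between \<open>last X\<close> and \<open>last Y\<close> has a common
    parent, which completes a square with \<open>v\<close>.\<close>
  have triangle: "comb_homotopic G (X @ [v]) (Y @ [v])"
    if XY: "ascending X" "ascending Y" "adjacent G (last X) v" "adjacent G (last Y) v"
      "d (last X) = m" "d (last Y) = m" "adjacent G (last X) (last Y)" for X Y
  proof -
    obtain x where "adjacent G x (last X)" "adjacent G x (last Y)" "d (last X) = Suc (d x)"
      using common_parent XY by metis
    then show ?thesis using square XY by metis
  qed
  have "comb_homotopic G (P @ [v]) (Q @ [v])"
  proof -
    consider "last P = last Q" | "adjacent G (last P) (last Q)"
      | x where "adjacent G x (last P)" "adjacent G x (last Q)" "d (last P) = Suc (d x)"
      | x where "adjacent G (last P) x" "adjacent G x (last Q)" "adjacent G x v" "d x = d (last P)"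
      using diamond[of "last P" v "last Q"] P Q v by metis
    then show ?thesis
    proof cases
      case 1
      then show ?thesis using same P Q by simp
    next
      case 2
      then show ?thesis using triangle P Q by simp
    next
      case (3 x)
      then show ?thesis using square P Q by simp
    next
      case (4 x)
      \<comment> \<open>An ascending walk to \<open>x\<close> mediates between the two
        triangles.\<close>
      then obtain Z where Z: "ascending Z" "last Z = x" using ascending_exists adjacent_in by metis
      have "comb_homotopic G (P @ [v]) (Z @ [v])" "comb_homotopic G (Z @ [v]) (Q @ [v])"
        using triangle 4 Z P Q by simp_all
      then show ?thesis by (rule comb_homotopic_trans)
    qed
  qed
  then show ?case using P Q by simp
qed

text \<open>By induction the walk without its last vertex may be replaced by an ascending one, so
  only the last edge matters: it goes up, down or stays on its level.\<close>

lemma homotopic_ascending: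
  assumes "walk G W" "hd W = r" "ascending A" "last A = last W"
  shows "comb_homotopic G W A"
  using assms
proof (induction W arbitrary: A rule: rev_induct)
  case Nil
  then show ?case by (simp add: walk_def)
next
  case (snoc v W)
  show ?case
  proof (cases "W = []")
    case True
    then have "last A = last [r]" using snoc.prems by simp
    then have "comb_homotopic G [r] A"
      using snoc.prems by (intro ascending_unique ascending.root) auto
    then show ?thesis using True snoc.prems by simp
  next
    case False
    define u where "u = last W"
    have W: "walk G W" "adjacent G u v" "hd W = r" "v \<in> fst G"
      using snoc.prems False by (auto simp: walk_snoc u_def)
    then have uv: "adjacent G v u" "u \<in> fst G" "u \<noteq> v"
      using adjacent_commute adjacent_in adjacent_irrefl by metis+
    \<comment> \<open>Every ascending walk to \<open>u\<close> is available here, so each case can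
      choose the one that suits its last edge.\<close>
    have extend: "comb_homotopic G (W @ [v]) (U @ [v])" if "ascending U" "last U = u" for U
      using comb_homotopic_snoc snoc.IH W that u_def by metis
    consider "d v = Suc (d u)" | "d u = Suc (d v)" | "d u = d v"
      using level_step[OF W(2)] level_step[OF uv(1)] by linarith
    then show ?thesis
    proof cases
      case 1
      obtain U where U: "ascending U" "last U = u" using ascending_exists uv by metis
      then have "ascending (U @ [v])" using 1 W by (intro ascending.snoc) auto
      then have "comb_homotopic G (U @ [v]) A" using ascending_unique snoc.prems by simp
      then show ?thesis using extend U comb_homotopic_trans by metis
    next
      case 2
      have A: "last A = v" "walk G A" using snoc.prems ascending_walk by auto
      then obtain p where p: "A = p @ [v]" by (metis append_butlast_last_id walk_nonempty)
      \<comment> \<open>For a descending edge, approach \<open>u\<close> through \<open>v\<close>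
        itself; the detour \<open>v u v\<close> is then deleted.\<close>
      have Au: "ascending (A @ [u])" using 2 A uv snoc.prems by (intro ascending.snoc) auto
      then have e: "comb_homotopic G (W @ [v]) (A @ [u, v])" using extend[of "A @ [u]"] by simp
      have "walk G (A @ [u, v])"
        using walk_snoc[of "A @ [u]" G v] ascending_walk[OF Au] W by simp
      then have "elementary G (A @ [u, v]) A"
        using elementary.deletion[of G p v u "[]"] A p by simp
      then show ?thesis using e elementary_comb_homotopic comb_homotopic_trans by metis
    next
      case 3
      \<comment> \<open>For an edge within a level, approach \<open>u\<close> through a common
        parent \<open>x\<close>; the triangle \<open>x u v\<close> then permits a shortcut.\<close>
      obtain x where x: "adjacent G x u" "adjacent G x v" "d u = Suc (d x)"
        using common_parent W 3 by metis
      then obtain X where X: "ascending X" "last X = x" using ascending_exists adjacent_in by metis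
      then obtain p where p: "X = p @ [x]" by (metis append_butlast_last_id ascending_walk walk_nonempty)
      have Xu: "ascending (X @ [u])" and Xv: "ascending (X @ [v])"
        using x X 3 by (auto intro: ascending.snoc)
      have "walk G (X @ [u, v])"
        using walk_snoc[of "X @ [u]" G v] ascending_walk[OF Xu] W by simp
      moreover have "x \<noteq> v" using x adjacent_irrefl by blast
      ultimately have "elementary G (X @ [u, v]) (X @ [v])"
        using elementary.shortcut[of G p x u v "[]"] ascending_walk[OF Xv] p by simp
      moreover have "comb_homotopic G (W @ [v]) (X @ [u, v])" using extend[OF Xu] by simp
      moreover have "comb_homotopic G (X @ [v]) A" using ascending_unique Xv snoc.prems by simp
      ultimately show ?thesis using elementary_comb_homotopic comb_homotopic_trans by metis
    qed
  qed
qed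

lemma rooted_walks_homotopic:
  assumes "walk G W" "walk G W'" "hd W = r" "hd W' = r" "last W = last W'"
  shows "comb_homotopic G W W'"
proof -
  have "last W \<in> fst G" using assms(1) by (auto simp: walk_def)
  then obtain A where "ascending A" "last A = last W" using ascending_exists by metis
  then show ?thesis
    using homotopic_ascending assms comb_homotopic_trans comb_homotopic_sym by metis
qed

end

section \<open>Levels in the basis graph\<close>

definition exchange :: "(nat \<Rightarrow> int) \<Rightarrow> nat \<Rightarrow> nat \<Rightarrow> nat \<Rightarrow> int" where
  "exchange \<alpha> i j = (\<lambda>k. \<alpha> k - std_basis i k + std_basis j k)"

lemma exchange_apply:
  "exchange \<alpha> i j k = \<alpha> k - (if k = i then 1 else 0) + (if k = j then 1 else 0)"
  by (simp add: exchange_def std_basis_def)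

text \<open>For two bases this is half their l1 distance, as \<open>excess_pair\<close> shows. The
  reference point \<open>\<beta>\<close> comes first so that \<open>excess n \<rho>\<close> can
  serve as the level function with root \<open>\<rho>\<close>.\<close>

definition excess :: "nat \<Rightarrow> (nat \<Rightarrow> int) \<Rightarrow> (nat \<Rightarrow> int) \<Rightarrow> nat" where
  "excess n \<beta> \<alpha> = (\<Sum>k=1..n. nat (\<alpha> k - \<beta> k))"

text \<open>Lowering \<open>i\<close> removes a unit only from a genuine surplus, while raising
  \<open>j\<close> adds one as soon as \<open>\<beta> j\<close> is already reached; hence one strict
  and one weak inequality. The integers avoid truncated subtraction.\<close>

lemma excess_exchange:
  assumes "i \<in> {1..n}" "j \<in> {1..n}" "i \<noteq> j"
  shows "int (excess n \<beta> (exchange \<alpha> i j)) =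
    int (excess n \<beta> \<alpha>) - (if \<alpha> i > \<beta> i then 1 else 0) + (if \<alpha> j \<ge> \<beta> j then 1 else 0)"
proof -
  let ?a = "if \<alpha> i > \<beta> i then 1 else 0 :: int" and ?b = "if \<alpha> j \<ge> \<beta> j then 1 else 0 :: int"
  have "int (excess n \<beta> (exchange \<alpha> i j)) =
      (\<Sum>k=1..n. int (nat (\<alpha> k - \<beta> k)) - (if k = i then ?a else 0) + (if k = j then ?b else 0))"
    unfolding excess_def of_nat_sum using assms(3)
    by (intro sum.cong) (auto simp: exchange_apply)
  also have "\<dots> = int (excess n \<beta> \<alpha>) - ?a + ?b"
    using assms by (simp add: excess_def sum.distrib sum_subtractf)
  finally show ?thesis .
qed

lemma l1_norm_exchange:
  assumes "i \<in> {1..n}" "j \<in> {1..n}" "i \<noteq> j"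
  shows "l1_norm n (\<lambda>k. exchange \<alpha> i j k - \<alpha> k) = 2"
proof -
  have "l1_norm n (\<lambda>k. exchange \<alpha> i j k - \<alpha> k) =
      (\<Sum>k=1..n. (if k = i then 1 else 0) + (if k = j then 1 else 0))"
    unfolding l1_norm_def using assms(3) by (intro sum.cong) (auto simp: exchange_apply)
  also have "\<dots> = 2" using assms by (simp add: sum.distrib)
  finally show ?thesis .
qed

lemma l1_norm_minus_commute: "l1_norm n (\<lambda>k. \<alpha> k - \<beta> k) = l1_norm n (\<lambda>k. \<beta> k - \<alpha> k)"
  by (simp add: l1_norm_def abs_minus_commute)

lemma adjacent_basis_graph:
  "adjacent (basis_graph n B) \<alpha> \<beta> \<longleftrightarrow>
     \<alpha> \<in> B \<and> \<beta> \<in> B \<and> l1_norm n (\<lambda>k. \<alpha> k - \<beta> k) = 2"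
  unfolding adjacent_def basis_graph_def using l1_norm_minus_commute[of n \<alpha> \<beta>]
  by (auto simp: doubleton_eq_iff)

locale polymatroid =
  fixes n :: nat and B :: "(nat \<Rightarrow> int) set"
  assumes polymatroid: "integral_polymatroid n B"
begin

abbreviation "G \<equiv> basis_graph n B"

section \<open>Exchange properties and rigidity of bases\<close>

lemma outside: "\<alpha> \<in> B \<Longrightarrow> k \<notin> {1..n} \<Longrightarrow> \<alpha> k = 0"
  using polymatroid unfolding integral_polymatroid_def simplex_points_def by blast

lemma sum_eq: "\<alpha> \<in> B \<Longrightarrow> \<beta> \<in> B \<Longrightarrow> (\<Sum>k=1..n. \<alpha> k) = (\<Sum>k=1..n. \<beta> k)"
  using polymatroid unfolding integral_polymatroid_def simplex_points_def
  by (metis (mono_tags, lifting) mem_Collect_eq subsetD)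

lemma exchange_down:
  assumes "\<alpha> \<in> B" "\<beta> \<in> B" "\<beta> i < \<alpha> i"
  obtains j where "i \<in> {1..n}" "j \<in> {1..n}" "\<alpha> j < \<beta> j" "exchange \<alpha> i j \<in> B"
proof -
  \<comment> \<open>Both bases vanish outside the ground set, so a strict inequality can only occur
    inside it.\<close>
  have "i \<in> {1..n}" using assms outside by (metis less_irrefl)
  then show ?thesis
    using that assms polymatroid unfolding integral_polymatroid_def exchange_def by blast
qed

text \<open>Bases have equal coordinate sums, so a termwise inequality leaves no slack.\<close>

lemma le_imp_eq:
  assumes "\<alpha> \<in> B" "\<beta> \<in> B" "\<And>k. \<alpha> k \<le> \<beta> k"
  shows "\<alpha> = \<beta>"
proof
  fix k
  show "\<alpha> k = \<beta> k"
  proof (cases "k \<in> {1..n}")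
    case True
    show ?thesis by (rule sum_mono_inv[OF sum_eq[OF assms(1,2)] _ True]) (simp_all add: assms(3))
  next
    case False
    then show ?thesis using outside[OF assms(1)] outside[OF assms(2)] by simp
  qed
qed

lemma excess_0: "\<alpha> \<in> B \<Longrightarrow> \<beta> \<in> B \<Longrightarrow> excess n \<beta> \<alpha> = 0 \<Longrightarrow> \<alpha> = \<beta>"
proof (rule le_imp_eq)
  fix k assume "\<alpha> \<in> B" "\<beta> \<in> B" "excess n \<beta> \<alpha> = 0"
  then show "\<alpha> k \<le> \<beta> k"
    using outside[of \<alpha> k] outside[of \<beta> k] by (cases "k \<in> {1..n}") (auto simp: excess_def)
qed

text \<open>The dual exchange property: the axiom prescribes the coordinate to lower, here the one
  to raise is prescribed. Exchanges move \<open>\<beta>\<close> towards \<open>\<alpha>\<close>; the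
  one that finally lowers \<open>j\<close> arrives at \<open>\<alpha>\<close>, and its reverse is
  the desired exchange.\<close>

lemma exchange_up:
  assumes "\<alpha> \<in> B" "\<beta> \<in> B" "\<alpha> j < \<beta> j"
  shows "\<exists>i\<in>{1..n}. \<beta> i < \<alpha> i \<and> exchange \<alpha> i j \<in> B"
  using assms(2,3)
proof (induction "excess n \<alpha> \<beta>" arbitrary: \<beta> rule: less_induct)
  case less
  \<comment> \<open>Lowering \<open>\<beta>\<close> at an index other than \<open>j\<close> whenever possible keeps \<open>\<alpha> j < \<beta> j\<close> until only \<open>j\<close>
    is left.\<close>
  obtain k where k: "\<alpha> k < \<beta> k" "k = j \<longrightarrow> (\<forall>l. l \<noteq> j \<longrightarrow> \<beta> l \<le> \<alpha> l)"
    using less.prems by (metis not_le)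
  obtain t where t: "k \<in> {1..n}" "t \<in> {1..n}" "\<beta> t < \<alpha> t" "exchange \<beta> k t \<in> B"
    using exchange_down[OF less.prems(1) assms(1) k(1)] by metis
  define \<gamma> where "\<gamma> = exchange \<beta> k t"
  have "k \<noteq> t" using k t by auto
  show ?case
  proof (cases "\<alpha> j < \<gamma> j")
    case True
    have "excess n \<alpha> \<gamma> < excess n \<alpha> \<beta>"
      using excess_exchange[OF t(1,2) \<open>k \<noteq> t\<close>, of \<alpha> \<beta>] k t by (simp add: \<gamma>_def)
    then obtain i where i: "i \<in> {1..n}" "\<gamma> i < \<alpha> i" "exchange \<alpha> i j \<in> B"
      using less.hyps[of \<gamma>] True t by (auto simp: \<gamma>_def)
    \<comment> \<open>\<open>\<gamma>\<close> lies below \<open>\<beta>\<close> only at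
      \<open>k\<close>, where it is still at least \<open>\<alpha> k\<close>; hence \<open>i\<close>
      is not \<open>k\<close>.\<close>
    have "\<beta> i < \<alpha> i" using i k by (auto simp: \<gamma>_def exchange_apply split: if_splits)
    then show ?thesis using i by blast
  next
    case False
    then have "k = j" using less.prems by (auto simp: \<gamma>_def exchange_apply split: if_splits)
    \<comment> \<open>With \<open>k = j\<close>, no other coordinate of \<open>\<beta>\<close>
      exceeds \<open>\<alpha>\<close>, and raising \<open>t\<close> by one does not pass
      \<open>\<alpha> t\<close>.\<close>
    then have "\<gamma> l \<le> \<alpha> l" for l
      using False k(2) t by (auto simp: \<gamma>_def exchange_apply not_less split: if_splits)
    then have "\<gamma> = \<alpha>" using le_imp_eq t assms by (metis \<gamma>_def)
    then have "\<alpha> = exchange \<beta> j t" using \<open>k = j\<close> \<gamma>_def by simp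
    then have "exchange \<alpha> t j = \<beta>" by (auto simp: exchange_apply fun_eq_iff)
    then show ?thesis using t less.prems by blast
  qed
qed

section \<open>Edges of the basis graph as single exchanges\<close>

lemma adjacent_exchangeI:
  assumes "\<alpha> \<in> B" "\<beta> \<in> B" "i \<in> {1..n}" "j \<in> {1..n}" "i \<noteq> j" "\<beta> = exchange \<alpha> i j"
  shows "adjacent G \<alpha> \<beta>"
  using assms l1_norm_exchange l1_norm_minus_commute by (simp add: adjacent_basis_graph)

text \<open>The absolute value of x is twice its positive part minus x, and the differences x sum to
  zero over two bases.\<close>

lemma excess_pair:
  assumes "\<alpha> \<in> B" "\<beta> \<in> B"
  shows "l1_norm n (\<lambda>k. \<alpha> k - \<beta> k) = 2 * int (excess n \<beta> \<alpha>)"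
proof -
  have "l1_norm n (\<lambda>k. \<alpha> k - \<beta> k) = (\<Sum>k=1..n. 2 * int (nat (\<alpha> k - \<beta> k)) - (\<alpha> k - \<beta> k))"
    unfolding l1_norm_def by (intro sum.cong) auto
  also have "\<dots> = 2 * int (excess n \<beta> \<alpha>)"
    using sum_eq[OF assms] by (simp add: sum_subtractf excess_def sum_distrib_left)
  finally show ?thesis .
qed

text \<open>Adjacency means excess 1, so one exchange towards \<open>\<beta>\<close> brings the
  excess to 0 and hits \<open>\<beta>\<close>.\<close>

lemma adjacent_exchangeE:
  assumes "adjacent G \<alpha> \<beta>"
  obtains i j where "i \<in> {1..n}" "j \<in> {1..n}" "i \<noteq> j" "\<beta> = exchange \<alpha> i j"
proof -
  have B: "\<alpha> \<in> B" "\<beta> \<in> B" "excess n \<beta> \<alpha> = 1"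
    using assms excess_pair[of \<alpha> \<beta>] by (auto simp: adjacent_basis_graph)
  then have "\<alpha> \<noteq> \<beta>" by (auto simp: excess_def)
  then obtain i where i: "\<beta> i < \<alpha> i" using B le_imp_eq by (metis not_le)
  obtain j where j: "i \<in> {1..n}" "j \<in> {1..n}" "\<alpha> j < \<beta> j" "exchange \<alpha> i j \<in> B"
    using exchange_down[OF B(1,2) i] by metis
  moreover have "i \<noteq> j" using i j by auto
  moreover have "excess n \<beta> (exchange \<alpha> i j) = 0"
    using excess_exchange[OF j(1,2) \<open>i \<noteq> j\<close>, of \<beta> \<alpha>] B i j by simp
  ultimately show ?thesis using that excess_0 B by metis
qed

lemma levelled:
  assumes "\<rho> \<in> B"
  shows "levelled_graph G (excess n \<rho>) \<rho>"
proof
  show "\<not> adjacent G u u" for u by (simp add: adjacent_basis_graph l1_norm_def)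
  show "u \<in> fst G" if "adjacent G u v" for u v
    using that unfolding adjacent_basis_graph by (simp add: basis_graph_def)
  show "\<rho> \<in> fst G" using assms by (simp add: basis_graph_def)
  show "excess n \<rho> \<rho> = 0" by (simp add: excess_def)
  show "v = \<rho>" if "v \<in> fst G" "excess n \<rho> v = 0" for v
    using that excess_0 assms by (simp add: basis_graph_def)
next
  fix u v assume "adjacent G u v"
  then obtain i j where ij: "i \<in> {1..n}" "j \<in> {1..n}" "i \<noteq> j" "v = exchange u i j"
    using adjacent_exchangeE by metis
  then show "excess n \<rho> v \<le> Suc (excess n \<rho> u)"
    using excess_exchange[OF ij(1-3), of \<rho> u] by (simp split: if_splits)
next
  fix v assume v: "v \<in> fst G" "0 < excess n \<rho> v"
  then have vB: "v \<in> B" by (simp add: basis_graph_def)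
  have "v \<noteq> \<rho>" using v by (auto simp: excess_def)
  then obtain i where i: "\<rho> i < v i" using le_imp_eq[OF vB assms] by (metis not_le)
  obtain j where j: "i \<in> {1..n}" "j \<in> {1..n}" "v j < \<rho> j" "exchange v i j \<in> B"
    using exchange_down[OF vB assms i] by metis
  have "i \<noteq> j" using i j by auto
  then have "adjacent G v (exchange v i j)" "excess n \<rho> v = Suc (excess n \<rho> (exchange v i j))"
    using excess_exchange[OF j(1,2), of \<rho> v] i j vB adjacent_exchangeI by auto
  then show "\<exists>u. adjacent G u v \<and> excess n \<rho> v = Suc (excess n \<rho> u)"
    using adjacent_commute by metis
next
  fix u v assume adj: "adjacent G u v" and eq: "excess n \<rho> u = excess n \<rho> v"
  then have B: "u \<in> B" "v \<in> B" by (auto simp: adjacent_basis_graph)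
  obtain i j where ij: "i \<in> {1..n}" "j \<in> {1..n}" "i \<noteq> j" "u = exchange v i j"
    using adjacent_exchangeE adj adjacent_commute by metis
  \<comment> \<open>Levels agree when the two corrections in \<open>excess_exchange\<close> are both
    1 or both 0.\<close>
  consider "\<rho> i < v i" "\<rho> j \<le> v j" | "v i \<le> \<rho> i" "v j < \<rho> j"
    using excess_exchange[OF ij(1-3), of \<rho> v] eq ij(4) by (force split: if_splits)
  then obtain x where "x \<in> B" "adjacent G v x" "adjacent G u x" "excess n \<rho> v = Suc (excess n \<rho> x)"
  proof cases
    case 1
    obtain t where t: "t \<in> {1..n}" "v t < \<rho> t" "exchange v i t \<in> B"
      using exchange_down[OF B(2) assms 1(1)] by metis
    have ne: "t \<noteq> i" "t \<noteq> j" using 1 t by auto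
    \<comment> \<open>The unit taken from \<open>i\<close> is given to the deficit \<open>t\<close>
      instead of \<open>j\<close>, so the new basis is one exchange from both \<open>v\<close> and
      \<open>u\<close>.\<close>
    have "exchange v i t = exchange u j t" using ij by (auto simp: exchange_apply fun_eq_iff)
    then have "adjacent G v (exchange v i t)" "adjacent G u (exchange v i t)"
      using adjacent_exchangeI[of _ "exchange v i t"] ij t ne B by metis+
    moreover have "excess n \<rho> v = Suc (excess n \<rho> (exchange v i t))"
      using excess_exchange[of i n t \<rho> v] ij t ne 1 by simp
    ultimately show ?thesis using that t by blast
  next
    case 2
    obtain s where s: "s \<in> {1..n}" "\<rho> s < v s" "exchange v s j \<in> B"
      using exchange_up[OF B(2) assms 2(2)] by metis
    have ne: "s \<noteq> i" "s \<noteq> j" using 2 s by auto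
    \<comment> \<open>Dually, \<open>j\<close> receives its unit from the surplus \<open>s\<close>
      instead of \<open>i\<close>.\<close>
    have "exchange v s j = exchange u s i" using ij by (auto simp: exchange_apply fun_eq_iff)
    then have "adjacent G v (exchange v s j)" "adjacent G u (exchange v s j)"
      using adjacent_exchangeI[of _ "exchange v s j"] ij s ne B by metis+
    moreover have "excess n \<rho> v = Suc (excess n \<rho> (exchange v s j))"
      using excess_exchange[of s n j \<rho> v] ij s ne 2 by simp
    ultimately show ?thesis using that s by blast
  qed
  then show "\<exists>x. adjacent G x u \<and> adjacent G x v \<and> excess n \<rho> u = Suc (excess n \<rho> x)"
    using eq adjacent_commute by metis
next
  fix u v w
  assume adj: "adjacent G u v" "adjacent G w v"
    and lev: "excess n \<rho> v = Suc (excess n \<rho> u)" "excess n \<rho> v = Suc (excess n \<rho> w)"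
  then have B: "u \<in> B" "v \<in> B" "w \<in> B" by (auto simp: adjacent_basis_graph)
  \<comment> \<open>A step down must move a unit from a surplus to a deficit relative to
    \<open>\<rho>\<close>.\<close>
  have lower: "\<exists>i\<in>{1..n}. \<exists>j\<in>{1..n}. z = exchange v i j \<and> \<rho> i < v i \<and> v j < \<rho> j"
    if z: "adjacent G z v" "excess n \<rho> v = Suc (excess n \<rho> z)" for z
  proof -
    obtain i j where ij: "i \<in> {1..n}" "j \<in> {1..n}" "i \<noteq> j" "z = exchange v i j"
      using adjacent_exchangeE z(1) adjacent_commute by metis
    then show ?thesis
      using excess_exchange[OF ij(1-3), of \<rho> v] z(2) by (force split: if_splits)
  qed
  obtain i j where u: "i \<in> {1..n}" "j \<in> {1..n}" "u = exchange v i j" "\<rho> i < v i" "v j < \<rho> j"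
    using lower adj lev by blast
  obtain k l where w: "k \<in> {1..n}" "l \<in> {1..n}" "w = exchange v k l" "\<rho> k < v k" "v l < \<rho> l"
    using lower adj lev by blast
  have ne: "i \<noteq> j" "i \<noteq> l" "k \<noteq> j" "k \<noteq> l" using u w by auto
  \<comment> \<open>If the two exchanges share an index, \<open>u\<close> and \<open>w\<close> are
    equal or one exchange apart; only disjoint exchanges require a further basis
    \<open>x\<close>.\<close>
  consider "i = k" "j = l" | "i = k" "j \<noteq> l" | "i \<noteq> k" "j = l" | "i \<noteq> k" "j \<noteq> l" by blast
  then show "u = w \<or> adjacent G u w \<or>
      (\<exists>x. adjacent G x u \<and> adjacent G x w \<and> excess n \<rho> u = Suc (excess n \<rho> x)) \<or>
      (\<exists>x. adjacent G u x \<and> adjacent G x w \<and> adjacent G x v \<and> excess n \<rho> x = excess n \<rho> u)"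
  proof cases
    case 1
    then show ?thesis using u w by simp
  next
    case 2
    then have "w = exchange u j l" using u w by (auto simp: exchange_apply fun_eq_iff)
    then show ?thesis using adjacent_exchangeI[of u w j l] 2 u w B by simp
  next
    case 3
    then have "w = exchange u k i" using u w by (auto simp: exchange_apply fun_eq_iff)
    then show ?thesis using adjacent_exchangeI[of u w k i] 3 u w B by simp
  next
    case 4
    have "w k < u k" using u w 4 ne by (simp add: exchange_apply)
    then obtain t where t: "t \<in> {1..n}" "u t < w t" "exchange u k t \<in> B"
      using exchange_down[OF B(1,3)] by metis
    \<comment> \<open>Exchanging \<open>u\<close> towards \<open>w\<close> leaves two outcomes:
      \<open>t = i\<close> gives a basis on the level of \<open>u\<close> that is also adjacent to
      \<open>v\<close>, and \<open>t = l\<close> performs both exchanges, giving a common lower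
      neighbour.\<close>
    have "t = i \<or> t = l" using t(2) u w by (auto simp: exchange_apply split: if_splits)
    then show ?thesis
    proof
      assume "t = i"
      define x where "x = exchange v k j"
      have x: "x = exchange u k i" "w = exchange x j l" "x = exchange v k j"
        using u w by (auto simp: x_def exchange_apply fun_eq_iff)
      then have xB: "x \<in> B" using t \<open>t = i\<close> by simp
      have "adjacent G u x" by (rule adjacent_exchangeI[OF _ _ _ _ _ x(1)]) (use xB u w 4 B in auto)
      moreover have "adjacent G x w"
        by (rule adjacent_exchangeI[OF _ _ _ _ _ x(2)]) (use xB u w 4 B in auto)
      moreover have "adjacent G v x"
        by (rule adjacent_exchangeI[OF _ _ _ _ _ x(3)]) (use xB u w ne B in auto)
      moreover have "excess n \<rho> x = excess n \<rho> u"
        using excess_exchange[of k n j \<rho> v] u w ne lev by (simp add: x_def)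
      ultimately show ?thesis using adjacent_commute by metis
    next
      assume "t = l"
      define x where "x = exchange u k l"
      have x: "x = exchange w i j" using u w by (auto simp: x_def exchange_apply fun_eq_iff)
      have xB: "x \<in> B" using t \<open>t = l\<close> x_def by simp
      have "adjacent G u x" by (rule adjacent_exchangeI[OF _ _ _ _ _ x_def]) (use xB w ne B in auto)
      moreover have "adjacent G w x"
        by (rule adjacent_exchangeI[OF _ _ _ _ _ x]) (use xB u ne B in auto)
      moreover have "excess n \<rho> u = Suc (excess n \<rho> x)"
        using excess_exchange[of k n l \<rho> u] u w ne 4 by (simp add: x_def exchange_apply)
      ultimately show ?thesis using adjacent_commute by metis
    qed
  qed
qed

end

theorem theorem1p3:
  fixes n :: nat and B :: "(nat \<Rightarrow> int) set" and W1 W2 :: "(nat \<Rightarrow> int) list"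
  assumes "integral_polymatroid n B"
    and "walk (basis_graph n B) W1"
    and "walk (basis_graph n B) W2"
    and "hd W1 = hd W2"
    and "last W1 = last W2"
  shows "comb_homotopic (basis_graph n B) W1 W2"
proof -
  interpret polymatroid n B using assms(1) by unfold_locales
  have "hd W1 \<in> B" using assms(2) by (auto simp: walk_def basis_graph_def)
  then interpret levelled_graph "basis_graph n B" "excess n (hd W1)" "hd W1" by (rule levelled)
  show ?thesis using rooted_walks_homotopic assms by metis
qed

end
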